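(* Let $\mathcal X$ be a (real or complex) Hilbert space, let $(e^{t\mathcal G})_{t\in\mathbb R}$ be a strongly continuous group on $\mathcal X$ with generator $\mathcal G$, and let $$\mathcal T_0:=\bigcup_{N\ge 1}\operatorname{Ker}\mathcal G^N .$$ Assume: (i) $\mathcal T_0$ is finite-dimensional; (ii) there is a bounded projection $\Pi_{\mathrm{thr}}$ of $\mathcal X$ onto $\mathcal T_0$ which commutes with the evolution, $e^{t\mathcal G}\Pi_{\mathrm{thr}}=\Pi_{\mathrm{thr}}e^{t\mathcal G}$ for all $t$; (iii) there is a functional $\mathscr E$ conserved by the evolution, $\mathscr E[e^{t\mathcal G}U]=\mathscr E[U]$, which is equivalent to the (squared) norm on $\operatorname{Ker}\Pi_{\mathrm{thr}}$: there are $0<c\le C'$ with $c\|U\|_{\mathcal X}^2\le \mathscr E[U]\le C'\|U\|_{\mathcal X}^2$ for all $U\in\operatorname{Ker}\Pi_{\mathrm{thr}}$. Then every solution $U(t)=e^{t\mathcal G}U_0$, $U_0\in\mathcal X$, admits a unique decomposition $$U(t)=U_{\mathrm{thr}}(t)+U_{\mathrm{bd}}(t),\qquad U_{\mathrm{thr}}(t)\in\mathcal T_0,\quad U_{\mathrm{bd}}(t)\in\operatorname{Ker}\Pi_{\mathrm{thr}},$$ where both components solve the evolution, $U_{\mathrm{thr}}$ is polynomial in $t$, and there is a constant $C$ (independent of $U_0$) with $$\sup_{t\in\mathbb R}\|U_{\mathrm{bd}}(t)\|_{\mathcal X}\le C\|U_{\mathrm{bd}}(0)\|_{\mathcal X}.$$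 Moreover there is no nontrivial finite-energy mode solution $e^{\lambda t}V$ with $\operatorname{Re}\lambda>0$ and $V\in\operatorname{Ker}\Pi_{\mathrm{thr}}$.
   Context: "Solves the evolution" means being of the form $t\mapsto e^{t\mathcal G}W$ for some $W\in\mathcal X$. A mode $e^{\lambda t}V$ is a solution of this form, $e^{t\mathcal G}V=e^{\lambda t}V$, and is nontrivial if $V\ne0$. The space $\mathcal T_0$ is called the full zero-frequency threshold space. *)

theory Defs
  imports "HOL-Analysis.Analysis"
begin

section \<open>Real or complex scalars\<close>

text \<open>The scalar fields are the intermediate fields of \<open>\<real> \<subseteq> \<complex>\<close>, presented through their isometric
  embedding into the complex numbers; hence they are exactly the real and the complex numbers
  (see \<open>range_to_complex\<close>).\<close>

class real_or_complex = real_normed_field + banach +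
  fixes to_complex :: "'a \<Rightarrow> complex"
  assumes to_complex_add: "to_complex (a + b) = to_complex a + to_complex b"
    and to_complex_mult: "to_complex (a * b) = to_complex a * to_complex b"
    and to_complex_scaleR: "to_complex (r *\<^sub>R a) = r *\<^sub>R to_complex a"
    and to_complex_one: "to_complex 1 = 1"
    and norm_to_complex: "norm (to_complex a) = norm a"

lemma to_complex_of_real: "to_complex (of_real r) = of_real r"
  by (simp add: of_real_def to_complex_scaleR to_complex_one)

instantiation real :: real_or_complex
begin
definition to_complex_real :: "real \<Rightarrow> complex" where "to_complex_real = complex_of_real"
instance by standard (auto simp: to_complex_real_def scaleR_conv_of_real)
end

instantiation complex :: real_or_complex
begin
definition to_complex_complex :: "complex \<Rightarrow> complex" where "to_complex_complex = id"
instance by standard (auto simp: to_complex_complex_def)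
end

lemma range_to_complex:
  "range (to_complex :: 'k::real_or_complex \<Rightarrow> complex) = \<real> \<or>
   range (to_complex :: 'k \<Rightarrow> complex) = UNIV"
proof (cases "\<exists>a::'k. Im (to_complex a) \<noteq> 0")
  case True
  then obtain a :: 'k where a: "Im (to_complex a) \<noteq> 0" by blast
  have "z \<in> range (to_complex :: 'k \<Rightarrow> complex)" for z
  proof -
    define s where "s = Im z / Im (to_complex a)"
    define r where "r = Re z - s * Re (to_complex a)"
    have "to_complex (r *\<^sub>R 1 + s *\<^sub>R a) = z"
      using a by (simp add: complex_eq_iff to_complex_add to_complex_scaleR
          to_complex_one r_def s_def)
    then show ?thesis by (metis rangeI)
  qed
  then show ?thesis by blast
next
  case False
  have "z \<in> range (to_complex :: 'k \<Rightarrow> complex)" if "z \<in> \<real>" for z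
    using that by (metis Reals_cases rangeI to_complex_of_real)
  with False show ?thesis by (auto simp: complex_is_Real_iff)
qed


section \<open>Hilbert spaces over the real or complex numbers\<close>

text \<open>The inner product is linear in its first argument. Completeness is part of the sort
  \<open>banach\<close>.\<close>

locale hilbert_space = vector_space scl
  for scl :: "'k::real_or_complex \<Rightarrow> 'x::banach \<Rightarrow> 'x" +
  fixes ip :: "'x \<Rightarrow> 'x \<Rightarrow> 'k"
  assumes scale_of_real: "scl (of_real r) x = r *\<^sub>R x"
    and ip_add_left: "ip (x + y) z = ip x z + ip y z"
    and ip_scale_left: "ip (scl a x) y = a * ip x y"
    and ip_commute: "to_complex (ip y x) = cnj (to_complex (ip x y))"
    and ip_self: "ip x x = of_real ((norm x)\<^sup>2)"

lemma hilbert_space_real: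
  "hilbert_space scaleR (inner :: 'x::{real_inner,banach} \<Rightarrow> 'x \<Rightarrow> real)"
  by unfold_locales
    (auto simp: algebra_simps inner_commute to_complex_real_def power2_norm_eq_inner)

lemma hilbert_space_complex: "hilbert_space (*) (\<lambda>x y. x * cnj y)"
  by unfold_locales
    (auto simp: algebra_simps to_complex_complex_def scaleR_conv_of_real complex_norm_square
        simp del: of_real_power)

definition bounded_op :: "('k::real_or_complex \<Rightarrow> 'x::banach \<Rightarrow> 'x) \<Rightarrow> ('x \<Rightarrow> 'x) \<Rightarrow> bool" where
  "bounded_op scl A \<longleftrightarrow> Vector_Spaces.linear scl scl A \<and> bounded_linear A"

definition finite_dim :: "('k::real_or_complex \<Rightarrow> 'x::banach \<Rightarrow> 'x) \<Rightarrow> 'x set \<Rightarrow> bool" where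
  "finite_dim scl S \<longleftrightarrow> (\<exists>B. finite B \<and> S = module.span scl B)"

definition bounded_projection_onto ::
    "('k::real_or_complex \<Rightarrow> 'x::banach \<Rightarrow> 'x) \<Rightarrow> ('x \<Rightarrow> 'x) \<Rightarrow> 'x set \<Rightarrow> bool" where
  "bounded_projection_onto scl P S \<longleftrightarrow> bounded_op scl P \<and> P \<circ> P = P \<and> range P = S"

definition Ker :: "('x \<Rightarrow> 'x::zero) \<Rightarrow> 'x set" where
  "Ker A = {x. A x = 0}"


section \<open>Strongly continuous groups\<close>

definition c0_group ::
    "('k::real_or_complex \<Rightarrow> 'x::banach \<Rightarrow> 'x) \<Rightarrow> (real \<Rightarrow> 'x \<Rightarrow> 'x) \<Rightarrow> bool" where
  "c0_group scl T \<longleftrightarrow>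
     (\<forall>t. bounded_op scl (T t)) \<and>
     T 0 = id \<and>
     (\<forall>s t. T (s + t) = T s \<circ> T t) \<and>
     (\<forall>x. continuous_on UNIV (\<lambda>t. T t x))"

text \<open>The generator is unbounded in general, so it is represented by its graph. The relational
  power then carries the natural domain \<open>D(G^N) = {x \<in> D(G^(N-1)). G^(N-1) x \<in> D(G)}\<close>.\<close>

definition generator :: "(real \<Rightarrow> 'x::banach \<Rightarrow> 'x) \<Rightarrow> ('x \<times> 'x) set" where
  "generator T = {(x, y). ((\<lambda>h. (T h x - x) /\<^sub>R h) \<longlongrightarrow> y) (at 0)}"

definition threshold_space :: "(real \<Rightarrow> 'x::banach \<Rightarrow> 'x) \<Rightarrow> 'x set" where
  "threshold_space T = (\<Union>N\<in>{1..}. {x. (x, 0) \<in> generator T ^^ N})"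

definition solves :: "(real \<Rightarrow> 'x \<Rightarrow> 'x) \<Rightarrow> (real \<Rightarrow> 'x) \<Rightarrow> bool" where
  "solves T U \<longleftrightarrow> (\<exists>W. \<forall>t. U t = T t W)"

definition polynomial_in_time :: "(real \<Rightarrow> 'x::real_vector) \<Rightarrow> bool" where
  "polynomial_in_time U \<longleftrightarrow> (\<exists>n c. \<forall>t. U t = (\<Sum>k\<le>n. t ^ k *\<^sub>R c k))"

definition is_mode ::
    "('k::real_or_complex \<Rightarrow> 'x::banach \<Rightarrow> 'x) \<Rightarrow> (real \<Rightarrow> 'x \<Rightarrow> 'x) \<Rightarrow> 'k \<Rightarrow> 'x \<Rightarrow> bool" where
  "is_mode scl T l V \<longleftrightarrow> (\<forall>t. T t V = scl (exp (l * of_real t)) V)"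

definition threshold_decomposition ::
    "(real \<Rightarrow> 'x::banach \<Rightarrow> 'x) \<Rightarrow> ('x \<Rightarrow> 'x) \<Rightarrow> 'x \<Rightarrow> (real \<Rightarrow> 'x) \<Rightarrow> (real \<Rightarrow> 'x) \<Rightarrow> bool" where
  "threshold_decomposition T P U0 Uthr Ubd \<longleftrightarrow>
     (\<forall>t. T t U0 = Uthr t + Ubd t \<and> Uthr t \<in> threshold_space T \<and> Ubd t \<in> Ker P)"

end

theory Submission
  imports Defs
begin

text \<open>On \<open>Ker G\<^sup>N\<close> the orbits are polynomial: the orbit of \<open>x\<close> has the orbit of \<open>G x\<close> as derivative,
  so one integrates \<open>N\<close> times. Since the projection commutes with the evolution, its range and its
  kernel are invariant, and applying it to a solution gives the only possible decomposition. On the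
  kernel the conserved functional is comparable to the squared norm, which bounds the orbits by
  \<open>sqrt (C' / c)\<close> times their initial norm and so excludes exponentially growing modes.\<close>

lemma bounded_linear_to_complex:
  "bounded_linear (to_complex :: 'k::real_or_complex \<Rightarrow> complex)"
  by (rule bounded_linear_intro[where K = 1])
    (auto simp: to_complex_add to_complex_scaleR norm_to_complex)

lemma to_complex_power: "to_complex (a ^ n) = to_complex a ^ n"
  by (induction n) (auto simp: to_complex_one to_complex_mult)

text \<open>The embedding is continuous, linear over the reals and multiplicative, so it passes
  through the exponential series term by term.\<close>

lemma to_complex_exp: "to_complex (exp a) = exp (to_complex a)"
proof -
  have "to_complex (exp a) = (\<Sum>n. to_complex (a ^ n /\<^sub>R fact n))"
    unfolding exp_def
    by (rule bounded_linear.suminf[OF bounded_linear_to_complex summable_exp_generic])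
  then show ?thesis
    by (simp add: exp_def to_complex_scaleR to_complex_power)
qed

text \<open>The embedding is isometric, so this reduces to the modulus of the complex exponential.
  It gives the growth rate of a mode over either scalar field.\<close>

lemma norm_exp_real_or_complex:
  fixes l :: "'k::real_or_complex"
  shows "norm (exp (l * of_real t)) = exp (Re (to_complex l) * t)"
  by (subst norm_to_complex[symmetric])
    (simp add: to_complex_exp to_complex_mult to_complex_of_real)

text \<open>The norm on \<open>'x\<close> is a priori homogeneous for real scalars only; for scalars
  in \<open>'k\<close> homogeneity comes from the inner product.\<close>

lemma (in hilbert_space) norm_scl: "norm (scl a x) = norm a * norm x"
proof -
  have "(norm (scl a x))\<^sup>2 = norm (to_complex (ip (scl a x) (scl a x)))"
    by (simp add: ip_self norm_to_complex del: of_real_power)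
  also have "\<dots> = norm a * norm (to_complex (ip x (scl a x)))"
    by (simp add: ip_scale_left to_complex_mult norm_mult norm_to_complex)
  \<comment> \<open>Exchanging the arguments conjugates the value and keeps its modulus; the second
    scalar then also stands in the linear slot.\<close>
  also have "\<dots> = norm a * norm (to_complex (ip (scl a x) x))"
    by (simp add: ip_commute[of x "scl a x"])
  also have "\<dots> = (norm a * norm x)\<^sup>2"
    by (simp add: ip_scale_left ip_self norm_to_complex norm_mult power2_eq_square del: of_real_power)
  finally show ?thesis by (simp add: power2_eq_iff_nonneg)
qed

lemma c0_group_add: "c0_group scl T \<Longrightarrow> T (s + t) x = T s (T t x)"
  by (simp add: c0_group_def)

lemma c0_group_zero: "c0_group scl T \<Longrightarrow> T 0 x = x"
  by (simp add: c0_group_def)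

lemma c0_group_bounded_linear: "c0_group scl T \<Longrightarrow> bounded_linear (T t)"
  by (simp add: c0_group_def bounded_op_def)

text \<open>By the group law the difference quotient at \<open>t\<close> is the image under
  \<open>T t\<close> of the one at 0, and the continuous map \<open>T t\<close> preserves the
  limit.\<close>

lemma c0_group_has_vector_derivative:
  assumes T: "c0_group scl T" and xy: "(x, y) \<in> generator T"
  shows "((\<lambda>t. T t x) has_vector_derivative T t y) (at t)"
proof -
  interpret Tt: bounded_linear "T t" by (rule c0_group_bounded_linear[OF T])
  have "((\<lambda>h. (T h x - x) /\<^sub>R h) \<longlongrightarrow> y) (at 0)"
    using xy by (simp add: generator_def)
  then have "((\<lambda>h. T t ((T h x - x) /\<^sub>R h)) \<longlongrightarrow> T t y) (at 0)"
    by (rule Tt.tendsto)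
  then have "((\<lambda>h. (T (t + h) x - T t x) /\<^sub>R h) \<longlongrightarrow> T t y) (at 0)"
    by (simp add: Tt.scaleR Tt.diff c0_group_add[OF T])
  then have "((\<lambda>h. norm ((T (t + h) x - T t x) /\<^sub>R h - T t y)) \<longlongrightarrow> 0) (at 0)"
    by (intro tendsto_norm_zero LIM_zero)
  moreover have "norm ((T (t + h) x - T t x) /\<^sub>R h - T t y)
      = norm (T (t + h) x - T t x - h *\<^sub>R T t y) / norm h" if "h \<noteq> 0" for h
  proof -
    have "(T (t + h) x - T t x) /\<^sub>R h - T t y = (T (t + h) x - T t x - h *\<^sub>R T t y) /\<^sub>R h"
      using that by (simp add: scaleR_diff_right)
    then show ?thesis by (simp add: divide_inverse mult.commute)
  qed
  \<comment> \<open>The two quotients agree for nonzero \<open>h\<close>, which suffices because the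
    limit at 0 ignores the point itself.\<close>
  ultimately have "((\<lambda>h. norm (T (t + h) x - T t x - h *\<^sub>R T t y) / norm h) \<longlongrightarrow> 0) (at 0)"
    by (auto elim!: Lim_transform_eventually simp: eventually_at_filter)
  then show ?thesis
    unfolding has_vector_derivative_def has_derivative_at
    by (simp add: bounded_linear_scaleR_left)
qed

text \<open>Termwise integration gives a polynomial antiderivative \<open>V\<close>, and
  \<open>U - V\<close> has zero derivative on the whole line, hence is constant.\<close>

lemma polynomial_in_time_antiderivative:
  fixes U :: "real \<Rightarrow> 'x::real_normed_vector"
  assumes der: "\<And>t. (U has_vector_derivative U' t) (at t)"
    and U': "polynomial_in_time U'"
  shows "polynomial_in_time U"
proof -
  obtain n c where c: "\<And>t. U' t = (\<Sum>k\<le>n. t ^ k *\<^sub>R c k)"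
    using U' by (auto simp: polynomial_in_time_def)
  define V where "V t = (\<Sum>k\<le>n. (t ^ Suc k / real (Suc k)) *\<^sub>R c k)" for t
  have "(V has_vector_derivative U' t) (at t)" for t
  proof -
    have "((\<lambda>t. (t ^ Suc k / real (Suc k)) *\<^sub>R c k) has_vector_derivative t ^ k *\<^sub>R c k) (at t)" for k
    proof -
      have "((\<lambda>t. t ^ Suc k / real (Suc k)) has_real_derivative t ^ k) (at t)"
        by (rule derivative_eq_intros refl | simp del: of_nat_Suc)+
      from has_vector_derivative_scaleR[OF this has_vector_derivative_const, of "c k"]
      show ?thesis by simp
    qed
    then show ?thesis
      unfolding V_def c by (intro has_vector_derivative_sum)
  qed
  then have "((\<lambda>t. U t - V t) has_vector_derivative 0) (at t)" for t
    using has_vector_derivative_diff[OF der] by fastforce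
  then obtain d where d: "\<And>t. U t - V t = d"
    using has_vector_derivative_zero_constant[of UNIV "\<lambda>t. U t - V t"] by auto
  \<comment> \<open>Integration shifts the coefficients up by one degree; the constant
    \<open>d\<close> fills the vacant degree 0.\<close>
  have "U t = (\<Sum>k\<le>Suc n. t ^ k *\<^sub>R (case k of 0 \<Rightarrow> d | Suc j \<Rightarrow> c j /\<^sub>R real (Suc j)))" for t
    using d[of t] by (simp add: V_def sum.atMost_Suc_shift algebra_simps divide_inverse del: sum.atMost_Suc)
  then show ?thesis
    unfolding polynomial_in_time_def by blast
qed

lemma polynomial_orbit_of_generator_relpow:
  assumes T: "c0_group scl T" and "(x, 0) \<in> generator T ^^ N"
  shows "polynomial_in_time (\<lambda>t. T t x)"
  using assms(2)
proof (induction N arbitrary: x)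
  case 0
  then have "x = 0" by simp
  then have "T t x = (\<Sum>k\<le>0. t ^ k *\<^sub>R 0)" for t
    using linear_0[OF bounded_linear.linear[OF c0_group_bounded_linear[OF T]]] by simp
  then show ?case
    unfolding polynomial_in_time_def by (intro exI[of _ 0] exI[of _ "\<lambda>_. 0"]) simp
next
  case (Suc N)
  \<comment> \<open>The relational power is split at its first factor, so that \<open>y\<close> is
    the image of \<open>x\<close> under the generator and the induction hypothesis applies to the
    orbit of \<open>y\<close>.\<close>
  then obtain y where y: "(x, y) \<in> generator T" "(y, 0) \<in> generator T ^^ N"
    by (meson relpow_Suc_D2)
  show ?case
    by (rule polynomial_in_time_antiderivative[OF c0_group_has_vector_derivative[OF T y(1)] Suc.IH[OF y(2)]])
qed

lemma polynomial_orbit_of_threshold_space: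
  assumes "c0_group scl T" and "x \<in> threshold_space T"
  shows "polynomial_in_time (\<lambda>t. T t x)"
  using assms polynomial_orbit_of_generator_relpow by (fastforce simp: threshold_space_def)

lemma conserved_energy_norm_bound:
  fixes E :: "'x::real_normed_vector \<Rightarrow> real"
  assumes "0 < c" and "c * (norm x)\<^sup>2 \<le> E x" and "E y \<le> C' * (norm y)\<^sup>2" and "E x = E y"
  shows "norm x \<le> sqrt (C' / c) * norm y"
proof -
  have "(norm x)\<^sup>2 \<le> C' / c * (norm y)\<^sup>2"
    using assms by (simp add: field_simps)
  then have "norm x \<le> sqrt (C' / c * (norm y)\<^sup>2)"
    by (rule real_le_rsqrt)
  then show ?thesis by (simp add: real_sqrt_mult real_sqrt_divide)
qed

lemma exp_mode_unbounded:
  fixes l :: "'k::real_or_complex"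
  assumes H: "hilbert_space scl ip" and V: "is_mode scl T l V" "V \<noteq> 0"
    and l: "Re (to_complex l) > 0"
  shows "\<exists>t. norm (T t V) > K"
proof -
  define r where "r = Re (to_complex l)"
  \<comment> \<open>Chosen so that \<open>r * t * norm V\<close> equals
    \<open>\<bar>K\<bar>\<close>; the bound \<open>1 + r * t \<le> exp (r * t)\<close> then already
    exceeds \<open>K\<close>, with \<open>norm V\<close> to spare.\<close>
  define t where "t = \<bar>K\<bar> / norm V / r"
  have "(1 + r * t) * norm V = norm V + \<bar>K\<bar>"
    using V l by (simp add: t_def r_def field_simps)
  then have "K < (1 + r * t) * norm V"
    using zero_less_norm_iff[of V] V(2) abs_ge_self[of K] by linarith
  also have "\<dots> \<le> exp (r * t) * norm V"
    by (intro mult_right_mono exp_ge_add_one_self) simp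
  also have "\<dots> = norm (T t V)"
    using V(1) by (simp add: is_mode_def hilbert_space.norm_scl[OF H] norm_exp_real_or_complex r_def)
  finally show ?thesis by blast
qed

theorem theorem1p2:
  fixes scl :: "'k::real_or_complex \<Rightarrow> 'x::banach \<Rightarrow> 'x"
    and ip :: "'x \<Rightarrow> 'x \<Rightarrow> 'k"
    and T :: "real \<Rightarrow> 'x \<Rightarrow> 'x"
    and P :: "'x \<Rightarrow> 'x"
    and E :: "'x \<Rightarrow> real"
    and c C' :: real
  assumes "hilbert_space scl ip"
    and "c0_group scl T"
    and "finite_dim scl (threshold_space T)"
    and "bounded_projection_onto scl P (threshold_space T)"
    and "\<And>t. T t \<circ> P = P \<circ> T t"
    and "\<And>t U. E (T t U) = E U"
    and "0 < c" and "c \<le> C'"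
    and "\<And>U. U \<in> Ker P \<Longrightarrow> c * (norm U)\<^sup>2 \<le> E U \<and> E U \<le> C' * (norm U)\<^sup>2"
  shows "(\<exists>C. \<forall>U0. \<exists>Uthr Ubd.
             threshold_decomposition T P U0 Uthr Ubd \<and>
             (\<forall>Vthr Vbd. threshold_decomposition T P U0 Vthr Vbd \<longrightarrow> Vthr = Uthr \<and> Vbd = Ubd) \<and>
             solves T Uthr \<and> solves T Ubd \<and>
             polynomial_in_time Uthr \<and>
             bdd_above (range (\<lambda>t. norm (Ubd t))) \<and>
             (SUP t. norm (Ubd t)) \<le> C * norm (Ubd 0)) \<and>
         \<not> (\<exists>l V. is_mode scl T l V \<and> V \<noteq> 0 \<and> Re (to_complex l) > 0 \<and> V \<in> Ker P)"
proof -
  \<comment> \<open>Depends only on the energy constants, hence serves all initial data at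
    once.\<close>
  let ?C = "sqrt (C' / c)"
  have P: "bounded_linear P" "\<And>x. P (P x) = P x" "range P = threshold_space T"
    using assms(4) by (auto simp: bounded_projection_onto_def bounded_op_def fun_eq_iff)
  have comm: "T t (P x) = P (T t x)" for t x
    using assms(5)[of t] by (simp add: fun_eq_iff)
  interpret P: bounded_linear P by (rule P(1))
  note Tlin = c0_group_bounded_linear[OF assms(2)]
  have Pthr: "P x = x" if "x \<in> threshold_space T" for x
    using that P(2) by (auto simp flip: P(3))
  have Ker_inv: "T t x \<in> Ker P" if "x \<in> Ker P" for t x
    using that comm[of t x] linear_0[OF bounded_linear.linear[OF Tlin]] by (simp add: Ker_def)
  have bound: "norm (T t x) \<le> ?C * norm x" if "x \<in> Ker P" for t x
    using conserved_energy_norm_bound[of c "T t x" E x C'] assms(6,7) assms(9)[OF that]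
      assms(9)[OF Ker_inv[OF that]] by auto
  have decomp: "\<exists>Uthr Ubd.
             threshold_decomposition T P U0 Uthr Ubd \<and>
             (\<forall>Vthr Vbd. threshold_decomposition T P U0 Vthr Vbd \<longrightarrow> Vthr = Uthr \<and> Vbd = Ubd) \<and>
             solves T Uthr \<and> solves T Ubd \<and>
             polynomial_in_time Uthr \<and>
             bdd_above (range (\<lambda>t. norm (Ubd t))) \<and>
             (SUP t. norm (Ubd t)) \<le> ?C * norm (Ubd 0)" for U0
  proof -
    let ?Uthr = "\<lambda>t. T t (P U0)" and ?Ubd = "\<lambda>t. T t (U0 - P U0)"
    have thr: "P U0 \<in> threshold_space T" and bd: "U0 - P U0 \<in> Ker P"
      using P by (auto simp: Ker_def P.diff)
    have "threshold_decomposition T P U0 ?Uthr ?Ubd"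
      unfolding threshold_decomposition_def
      using Ker_inv[OF bd] P(3)
      by (auto simp: comm linear_diff[OF bounded_linear.linear[OF Tlin]])
    moreover have "Vthr = ?Uthr \<and> Vbd = ?Ubd" if V: "threshold_decomposition T P U0 Vthr Vbd" for Vthr Vbd
    proof -
      have "Vthr t = ?Uthr t \<and> Vbd t = ?Ubd t" for t
      proof -
        have V: "T t U0 = Vthr t + Vbd t" "Vthr t \<in> threshold_space T" "P (Vbd t) = 0"
          using V by (auto simp: threshold_decomposition_def Ker_def)
        \<comment> \<open>Applying \<open>P\<close> to the given decomposition fixes
          \<open>Vthr t\<close> and kills \<open>Vbd t\<close>, leaving
          \<open>P (T t U0)\<close>.\<close>
        have "?Uthr t = Vthr t"
          by (simp add: comm V P.add Pthr)
        then show ?thesis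
          using V(1) by (simp add: linear_diff[OF bounded_linear.linear[OF Tlin]])
      qed
      then show ?thesis by auto
    qed
    moreover have "polynomial_in_time ?Uthr"
      by (rule polynomial_orbit_of_threshold_space[OF assms(2) thr])
    \<comment> \<open>Boundedness is recorded separately, since a real \<open>SUP\<close> is
      meaningful only for a set that is bounded above.\<close>
    moreover have "bdd_above (range (\<lambda>t. norm (?Ubd t)))"
      using bound[OF bd] by (intro bdd_aboveI2)
    moreover have "(SUP t. norm (?Ubd t)) \<le> ?C * norm (?Ubd 0)"
      using bound[OF bd] by (intro cSUP_least) (auto simp: c0_group_zero[OF assms(2)])
    moreover have "solves T ?Uthr" "solves T ?Ubd"
      unfolding solves_def by blast+
    ultimately show ?thesis by blast
  qed
  \<comment> \<open>A growing mode in \<open>Ker P\<close> would exceed the level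
    \<open>?C * norm V\<close> at some time, against \<open>bound\<close>.\<close>
  have "\<not> (is_mode scl T l V \<and> V \<noteq> 0 \<and> Re (to_complex l) > 0 \<and> V \<in> Ker P)" for l V
    using exp_mode_unbounded[OF assms(1), of T l V "?C * norm V"] bound[of V] by (meson not_le)
  with decomp show ?thesis by blast
qed

end
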